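(* Let $(\mathscr{A},\langle\cdot,\cdot\rangle)$ be a (finite-dimensional, real) metric Jordan algebra and assume that $\langle\cdot,\cdot\rangle$ is associative. Then the Jordan-Levi-Civita connection is given by $$\nabla_XY=\frac12XY\quad\text{for all }X,Y\in\mathscr{A}.$$ Moreover, the Jordan curvature tensor satisfies $$R(X,Y)Z+R(Y,Z)X+R(Z,X)Y=0\quad\text{for all }X,Y,Z\in\mathscr{A}.$$
   Context: A (real) Jordan algebra is a real vector space $\mathscr{A}$ with a bilinear product satisfying $XY=YX$ and $X(X^2Y)=X^2(XY)$. A metric Jordan algebra is a Jordan algebra with a (positive definite) inner product $\langle\cdot,\cdot\rangle$; the inner product is associative if $\langle XY,Z\rangle=\langle X,YZ\rangle$ for all $X,Y,Z$. The Jordan-Levi-Civita connection is the unique bilinear map $(X,Y)\mapsto\nabla_XY$ with $\nabla_XY+\nabla_YX=XY$ and $\langle\nabla_XY,Z\rangle=\langle Y,\nabla_XZ\rangle$ for all $X,Y,Z$. The Jordan curvature tensor is $R(X,Y)Z=-\nabla_X\nabla_YZ-\nabla_Y\nabla_XZ+\nabla_{XY}Z$. *)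

theory Defs
  imports "HOL-Analysis.Analysis"
begin

text \<open>A real vector space with a positive definite inner product is a type of class
  \<open>real_inner\<close>. The class \<open>euclidean_space\<close> is avoided because it excludes dimension zero.\<close>

definition finite_dimensional :: "'a::real_vector itself \<Rightarrow> bool" where
  "finite_dimensional _ \<longleftrightarrow> (\<exists>B::'a set. finite B \<and> span B = UNIV)"

locale jordan_algebra =
  fixes mul :: "'a::real_vector \<Rightarrow> 'a \<Rightarrow> 'a"  (infixl "\<odot>" 70)
  assumes bilinear_mul: "bilinear (\<odot>)"
    and mul_commute: "X \<odot> Y = Y \<odot> X"
    and jordan_identity: "X \<odot> ((X \<odot> X) \<odot> Y) = (X \<odot> X) \<odot> (X \<odot> Y)"

locale metric_jordan_algebra = jordan_algebra mul
  for mul :: "'a::real_inner \<Rightarrow> 'a \<Rightarrow> 'a"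

definition associative_inner :: "('a::real_inner \<Rightarrow> 'a \<Rightarrow> 'a) \<Rightarrow> bool" where
  "associative_inner mul \<longleftrightarrow> (\<forall>X Y Z. mul X Y \<bullet> Z = X \<bullet> mul Y Z)"

definition is_jordan_levi_civita ::
  "('a::real_inner \<Rightarrow> 'a \<Rightarrow> 'a) \<Rightarrow> ('a \<Rightarrow> 'a \<Rightarrow> 'a) \<Rightarrow> bool" where
  "is_jordan_levi_civita mul D \<longleftrightarrow>
     bilinear D \<and>
     (\<forall>X Y. D X Y + D Y X = mul X Y) \<and>
     (\<forall>X Y Z. D X Y \<bullet> Z = Y \<bullet> D X Z)"

text \<open>The description is proper for every finite-dimensional metric Jordan algebra; see
  \<open>ex1_jordan_levi_civita\<close> below.\<close>

definition jordan_levi_civita ::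
  "('a::real_inner \<Rightarrow> 'a \<Rightarrow> 'a) \<Rightarrow> 'a \<Rightarrow> 'a \<Rightarrow> 'a" where
  "jordan_levi_civita mul = (THE D. is_jordan_levi_civita mul D)"

definition jordan_curvature ::
  "('a::real_inner \<Rightarrow> 'a \<Rightarrow> 'a) \<Rightarrow> 'a \<Rightarrow> 'a \<Rightarrow> 'a \<Rightarrow> 'a" where
  "jordan_curvature mul X Y Z =
     (let D = jordan_levi_civita mul
      in - D X (D Y Z) - D Y (D X Z) + D (mul X Y) Z)"

lemma riesz_finite_dimensional:
  fixes f :: "'a::real_inner \<Rightarrow> real"
  assumes "finite_dimensional TYPE('a)" and f: "linear f"
  shows "\<exists>v. \<forall>z. f z = v \<bullet> z"
proof -
  obtain B :: "'a set" where B: "finite B" "span B = UNIV"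
    using assms(1) by (auto simp: finite_dimensional_def)
  obtain C where C: "finite C" "span C = span B" "pairwise orthogonal C"
    using basis_orthogonal[OF B(1)] by blast
  define v where "v = (\<Sum>c\<in>C. (f c / (c \<bullet> c)) *\<^sub>R c)"
  have on_C: "f z = v \<bullet> z" if "z \<in> C" for z
  proof -
    have "v \<bullet> z = (\<Sum>c\<in>C. (f c / (c \<bullet> c)) * (c \<bullet> z))"
      by (simp add: v_def inner_sum_left)
    also have "\<dots> = (\<Sum>c\<in>C. if c = z then f z / (z \<bullet> z) * (z \<bullet> z) else 0)"
      using C(3) that by (intro sum.cong) (auto simp: pairwise_def orthogonal_def)
    also have "\<dots> = f z / (z \<bullet> z) * (z \<bullet> z)"
      using C(1) that by simp
    also have "\<dots> = f z"
      using linear_0[OF f] by (cases "z = 0") auto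
    finally show ?thesis by simp
  qed
  have "linear (\<lambda>z. v \<bullet> z)"
    by (simp add: bounded_linear_inner_right bounded_linear.linear)
  then have "f z = v \<bullet> z" for z
    using linear_eq_on_span[OF f, of "\<lambda>z. v \<bullet> z" C z] on_C B(2) C(2) by auto
  then show ?thesis by blast
qed

lemma ex1_jordan_levi_civita:
  fixes mul :: "'a::real_inner \<Rightarrow> 'a \<Rightarrow> 'a"
  assumes fin: "finite_dimensional TYPE('a)" and "metric_jordan_algebra mul"
  shows "\<exists>!D. is_jordan_levi_civita mul D"
proof -
  interpret metric_jordan_algebra mul by fact
  note bil = bilinear_ladd[OF bilinear_mul] bilinear_radd[OF bilinear_mul]
    bilinear_lmul[OF bilinear_mul] bilinear_rmul[OF bilinear_mul]
  have eqI: "u = w" if "\<And>z. u \<bullet> z = w \<bullet> z" for u w :: 'a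
    using that by (metis vector_eq_rdot)
  have "\<exists>v. \<forall>Z. (mul X Y \<bullet> Z + mul X Z \<bullet> Y - mul Y Z \<bullet> X) / 2 = v \<bullet> Z" for X Y
    by (rule riesz_finite_dimensional[OF fin], rule linearI)
       (auto simp: bil inner_add_left inner_add_right algebra_simps add_divide_distrib
         diff_divide_distrib)
  then obtain D where D:
    "\<And>X Y Z. D X Y \<bullet> Z = (mul X Y \<bullet> Z + mul X Z \<bullet> Y - mul Y Z \<bullet> X) / 2"
    by metis
  have "bilinear D"
    unfolding bilinear_def
    by (intro conjI allI linearI eqI)
       (auto simp: D bil inner_add_left inner_add_right field_simps)
  moreover have "D X Y + D Y X = mul X Y" for X Y
    by (rule eqI) (simp add: D inner_add_left mul_commute[of Y X] field_simps)
  moreover have "D X Y \<bullet> Z = Y \<bullet> D X Z" for X Y Z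
    by (simp add: D inner_commute[of Y "D X Z"] mul_commute[of Z Y])
  ultimately have "is_jordan_levi_civita mul D"
    by (simp add: is_jordan_levi_civita_def)
  moreover have "E = D" if E: "is_jordan_levi_civita mul E" for E
  proof (intro ext eqI)
    fix X Y Z
    have sum: "E A B \<bullet> C + E B A \<bullet> C = mul A B \<bullet> C" for A B C
      using E by (metis inner_add_left is_jordan_levi_civita_def)
    have sym: "E A B \<bullet> C = E A C \<bullet> B" for A B C
      using E by (metis inner_commute is_jordan_levi_civita_def)
    show "E X Y \<bullet> Z = D X Y \<bullet> Z"
      using sum[of X Y Z] sum[of X Z Y] sum[of Y Z X] sym[of X Y Z] sym[of Y X Z] sym[of Z X Y]
      by (simp add: D)
  qed
  ultimately show ?thesis by blast
qed

end

theory Submission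
  imports Defs
begin

text \<open>The connection is characterised by two conditions: its symmetrisation is the product, and each
  \<open>D X\<close> is self-adjoint. Half the product satisfies the first by commutativity. For the second,
  associativity of the inner product together with commutativity says precisely that each
  multiplication operator \<open>Y \<mapsto> X \<odot> Y\<close> is self-adjoint. Uniqueness of the connection then
  gives the first claim.

  Consequently the curvature is
  \<open>- (1/4) X(YZ) - (1/4) Y(XZ) + (1/2) (XY)Z\<close>. In the cyclic sum, commutativity leaves only the three
  products \<open>X(YZ)\<close>, \<open>Y(ZX)\<close>, \<open>Z(XY)\<close>. Each arises twice with coefficient
  \<open>- 1/4\<close>, from the iterated derivatives, and once with coefficient \<open>1/2\<close>, from the
  derivative along a product, so the sum vanishes.\<close>

lemma half_mul_is_jordan_levi_civita:
  fixes mul :: "'a::real_inner \<Rightarrow> 'a \<Rightarrow> 'a"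
  assumes bil: "bilinear mul"
    and comm: "\<And>X Y. mul X Y = mul Y X"
    and assoc: "associative_inner mul"
  shows "is_jordan_levi_civita mul (\<lambda>X Y. (1/2) *\<^sub>R mul X Y)"
proof -
  have "bilinear (\<lambda>X Y. (1/2) *\<^sub>R mul X Y)"
    using bil unfolding bilinear_def by (auto intro: linear_compose_scale_right)
  moreover have "(1/2) *\<^sub>R mul X Y + (1/2) *\<^sub>R mul Y X = mul X Y" for X Y
    by (simp add: comm[of Y X] flip: scaleR_add_left)
  moreover have "mul X Y \<bullet> Z = Y \<bullet> mul X Z" for X Y Z
    using assoc comm[of X Y] by (simp add: associative_inner_def)
  ultimately show ?thesis
    by (simp add: is_jordan_levi_civita_def)
qed

lemma cyclic_sum_jordan_curvature:
  fixes mul :: "'a::real_inner \<Rightarrow> 'a \<Rightarrow> 'a"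
  assumes bil: "bilinear mul"
    and comm: "\<And>X Y. mul X Y = mul Y X"
    and half: "\<And>X Y. jordan_levi_civita mul X Y = (1/2) *\<^sub>R mul X Y"
  shows "jordan_curvature mul X Y Z + jordan_curvature mul Y Z X
         + jordan_curvature mul Z X Y = 0"
proof -
  have R: "jordan_curvature mul A B C =
      - (1/4) *\<^sub>R mul A (mul B C) - (1/4) *\<^sub>R mul B (mul C A) + (1/2) *\<^sub>R mul C (mul A B)"
    for A B C
    by (simp add: jordan_curvature_def half bilinear_rmul[OF bil] comm[of A C]
        comm[of "mul A B" C])
  have "(1/2) *\<^sub>R V = (1/4) *\<^sub>R V + (1/4) *\<^sub>R V" for V :: 'a
    by (simp flip: scaleR_add_left)
  then show ?thesis
    by (simp add: R)
qed

theorem lemma4p1: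
  fixes mul :: "'a::real_inner \<Rightarrow> 'a \<Rightarrow> 'a"
  assumes "finite_dimensional TYPE('a)"
    and "metric_jordan_algebra mul"
    and "associative_inner mul"
  shows "(\<forall>X Y. jordan_levi_civita mul X Y = (1/2) *\<^sub>R mul X Y) \<and>
         (\<forall>X Y Z. jordan_curvature mul X Y Z + jordan_curvature mul Y Z X
                  + jordan_curvature mul Z X Y = 0)"
proof -
  interpret metric_jordan_algebra mul by fact
  have "is_jordan_levi_civita mul (\<lambda>X Y. (1/2) *\<^sub>R mul X Y)"
    using bilinear_mul mul_commute assms(3) by (rule half_mul_is_jordan_levi_civita)
  then have "jordan_levi_civita mul = (\<lambda>X Y. (1/2) *\<^sub>R mul X Y)"
    unfolding jordan_levi_civita_def
    by (rule the1_equality[OF ex1_jordan_levi_civita[OF assms(1,2)]])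
  then have half: "jordan_levi_civita mul X Y = (1/2) *\<^sub>R mul X Y" for X Y
    by simp
  show ?thesis
    using half cyclic_sum_jordan_curvature[OF bilinear_mul mul_commute half] by blast
qed

end
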